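(* Let $G$ be a group with a finite symmetric set of generators $S$, $e\notin S$, and suppose that $G$ is $\delta$-hyperbolic with respect to the word metric $d_S$, for some real $\delta\ge 0$. Let $d\in\mathbb{N}$ with $d\geq 32\delta+20$ and let $P_d(G)=P_d(G,S)$ be the Rips complex. Let $H$ be a finite subgroup of $G$. Then the fixed point set $P_d(G)^H$ is contractible.
   Context: Word metric: $S$ is a finite generating set of $G$ with $S=S^{-1}$ and $e\notin S$. For $x,y\in G$, $d_S(x,y)$ is the minimal number $n$ such that $x^{-1}y=s_1\cdots s_n$ with $s_i\in S$. This is a left-invariant metric on $G$. Hyperbolicity: A metric space $X$ with metric $d(\cdot,\cdot)$ is $\delta$-hyperbolic ($\delta\ge 0$) if for all $x,y,z,t\in X$, $d(x,y)+d(z,t)\le\max\{d(x,z)+d(y,t),\,d(x,t)+d(y,z)\}+2\delta$. The group $G$ is $\delta$-hyperbolic (relative to $S$) if the metric space $(G,d_S)$ is $\delta$-hyperbolic. Rips complex: For $d\in\mathbb{N}$, $P_d(G,S)$ is the simplicial complex with vertex set $G$ whose $k$-simplices are given by $(k+1)$-tuples $(g_0,\dots,g_k)$ (regarded as unordered sets of vertices) of pairwise distinct elements of $G$ with $\max_{0\le i,j\le k}d_S(g_i,g_j)\le d$. $G$ acts simplicially by $g\cdot(g_0,\dots,g_k)=(gg_0,\dots,gg_k)$. The fixed point set $P_d(G)^H$ is the set of points of the geometric realization of $P_d(G,S)$ that are fixed by every $h\in H$ (not only fixed vertices). *)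

theory Defs
  imports "HOL-Analysis.Analysis" "HOL-Algebra.Generated_Groups"
begin

definition word_product :: "('a, 'b) monoid_scheme \<Rightarrow> 'a list \<Rightarrow> 'a" where
  "word_product G ss = foldr (mult G) ss (one G)"

(* Only meaningful for x and y in the carrier and when every element of the carrier
   is a product of elements of S; otherwise the LEAST may be unspecified. *)
definition word_dist :: "('a, 'b) monoid_scheme \<Rightarrow> 'a set \<Rightarrow> 'a \<Rightarrow> 'a \<Rightarrow> nat" where
  "word_dist G S x y =
     (LEAST n. \<exists>ss. length ss = n \<and> set ss \<subseteq> S \<and> word_product G ss = inv\<^bsub>G\<^esub> x \<otimes>\<^bsub>G\<^esub> y)"

definition gromov_hyperbolic :: "'a set \<Rightarrow> ('a \<Rightarrow> 'a \<Rightarrow> real) \<Rightarrow> real \<Rightarrow> bool" where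
  "gromov_hyperbolic X dst \<delta> \<longleftrightarrow>
     (\<forall>x\<in>X. \<forall>y\<in>X. \<forall>z\<in>X. \<forall>t\<in>X.
        dst x y + dst z t \<le> max (dst x z + dst y t) (dst x t + dst y z) + 2 * \<delta>)"

definition hyperbolic_group :: "('a, 'b) monoid_scheme \<Rightarrow> 'a set \<Rightarrow> real \<Rightarrow> bool" where
  "hyperbolic_group G S \<delta> \<longleftrightarrow>
     gromov_hyperbolic (carrier G) (\<lambda>x y. real (word_dist G S x y)) \<delta>"

(* An abstract simplicial complex is given by the set K of its simplices, each a finite
   nonempty set of vertices.  A point of the realization is the function t of its
   barycentric coordinates. *)

definition supp :: "('v \<Rightarrow> real) \<Rightarrow> 'v set" where
  "supp t = {v. t v \<noteq> 0}"

definition realization_points :: "'v set set \<Rightarrow> ('v \<Rightarrow> real) set" where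
  "realization_points K = {t. (\<forall>v. 0 \<le> t v) \<and> supp t \<in> K \<and> (\<Sum>v\<in>supp t. t v) = 1}"

definition closed_simplex :: "'v set set \<Rightarrow> 'v set \<Rightarrow> ('v \<Rightarrow> real) set" where
  "closed_simplex K \<sigma> = {t \<in> realization_points K. supp t \<subseteq> \<sigma>}"

(* The weak topology: a set is open iff it meets every closed simplex in a relatively
   open set.  The topology of functions into the reals is pointwise convergence, which on
   functions supported in a finite set \<sigma> is the Euclidean topology. *)
definition realization :: "'v set set \<Rightarrow> ('v \<Rightarrow> real) topology" where
  "realization K = topology (\<lambda>U. U \<subseteq> realization_points K \<and>
     (\<forall>\<sigma>\<in>K. openin (top_of_set (closed_simplex K \<sigma>)) (U \<inter> closed_simplex K \<sigma>)))"

lemma openin_realization: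
  "openin (realization K) U \<longleftrightarrow> U \<subseteq> realization_points K \<and>
     (\<forall>\<sigma>\<in>K. openin (top_of_set (closed_simplex K \<sigma>)) (U \<inter> closed_simplex K \<sigma>))"
proof -
  have "istopology (\<lambda>U. U \<subseteq> realization_points K \<and>
     (\<forall>\<sigma>\<in>K. openin (top_of_set (closed_simplex K \<sigma>)) (U \<inter> closed_simplex K \<sigma>)))"
    unfolding istopology_def
  proof (intro conjI allI impI ballI)
    fix A B \<sigma>
    assume A: "A \<subseteq> realization_points K \<and>
        (\<forall>\<sigma>\<in>K. openin (top_of_set (closed_simplex K \<sigma>)) (A \<inter> closed_simplex K \<sigma>))"
      and B: "B \<subseteq> realization_points K \<and>
        (\<forall>\<sigma>\<in>K. openin (top_of_set (closed_simplex K \<sigma>)) (B \<inter> closed_simplex K \<sigma>))"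
      and \<sigma>: "\<sigma> \<in> K"
    have "openin (top_of_set (closed_simplex K \<sigma>))
        ((A \<inter> closed_simplex K \<sigma>) \<inter> (B \<inter> closed_simplex K \<sigma>))"
      by (rule openin_Int) (use A B \<sigma> in blast)+
    also have "(A \<inter> closed_simplex K \<sigma>) \<inter> (B \<inter> closed_simplex K \<sigma>) =
        A \<inter> B \<inter> closed_simplex K \<sigma>" by blast
    finally show "openin (top_of_set (closed_simplex K \<sigma>)) (A \<inter> B \<inter> closed_simplex K \<sigma>)" .
  next
    fix \<U> \<sigma>
    assume "\<forall>A\<in>\<U>. A \<subseteq> realization_points K \<and>
        (\<forall>\<sigma>\<in>K. openin (top_of_set (closed_simplex K \<sigma>)) (A \<inter> closed_simplex K \<sigma>))"
      and "\<sigma> \<in> K"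
    then have "openin (top_of_set (closed_simplex K \<sigma>)) (\<Union>A\<in>\<U>. A \<inter> closed_simplex K \<sigma>)"
      by (intro openin_Union) auto
    also have "(\<Union>A\<in>\<U>. A \<inter> closed_simplex K \<sigma>) = \<Union>\<U> \<inter> closed_simplex K \<sigma>" by blast
    finally show "openin (top_of_set (closed_simplex K \<sigma>)) (\<Union>\<U> \<inter> closed_simplex K \<sigma>)" .
  qed blast+
  then show ?thesis
    unfolding realization_def by simp
qed

(* The map induced on realizations by a map f of vertices: the affine extension of f to
   each simplex, so the coordinate at w is the sum of the coordinates over the fibre of w. *)
definition realization_map :: "('v \<Rightarrow> 'w) \<Rightarrow> ('v \<Rightarrow> real) \<Rightarrow> ('w \<Rightarrow> real)" where
  "realization_map f t = (\<lambda>w. \<Sum>v\<in>{v \<in> supp t. f v = w}. t v)"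

definition rips_complex :: "('a, 'b) monoid_scheme \<Rightarrow> 'a set \<Rightarrow> nat \<Rightarrow> 'a set set" where
  "rips_complex G S d = {\<sigma>. finite \<sigma> \<and> \<sigma> \<noteq> {} \<and> \<sigma> \<subseteq> carrier G \<and>
     (\<forall>g\<in>\<sigma>. \<forall>h\<in>\<sigma>. word_dist G S g h \<le> d)}"

definition rips_fixed_points ::
    "('a, 'b) monoid_scheme \<Rightarrow> 'a set \<Rightarrow> nat \<Rightarrow> 'a set \<Rightarrow> ('a \<Rightarrow> real) set" where
  "rips_fixed_points G S d H = {t \<in> realization_points (rips_complex G S d).
     \<forall>h\<in>H. realization_map (\<lambda>g. h \<otimes>\<^bsub>G\<^esub> g) t = t}"

(* The library's contractible_space holds for the empty space, which is not contractible
   in the usual sense; hence the nonemptiness clause. *)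
definition nonempty_contractible_space :: "'p topology \<Rightarrow> bool" where
  "nonempty_contractible_space X \<longleftrightarrow> topspace X \<noteq> {} \<and> contractible_space X"

end

theory Submission
  imports Defs
begin

text \<open>
  The proof is a discrete Morse-type collapse. Let \<open>radius v\<close> be the largest distance from \<open>v\<close> to
  a point of the finite subgroup \<open>H\<close>. This function on the vertices is invariant under left
  multiplication by \<open>H\<close>, and hyperbolicity makes it behave like the distance to a single point:
  it satisfies the four-point inequality in place of such a distance
  (\<open>radius_four_point\<close>). Two consequences carry the proof. The vertices whose radius is close to
  the minimum have small diameter, hence span a simplex (\<open>sublevel_diameter\<close>). A vertex \<open>v\<close> of
  larger radius is dominated: moving some way along a geodesic from \<open>v\<close> to a vertex of minimal
  radius leads to a vertex \<open>w\<close> of smaller radius such that every vertex of radius at most that of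
  \<open>v\<close> that is adjacent to \<open>v\<close> is adjacent to \<open>w\<close> (\<open>exists_dominating_vertex\<close>).

  The topological half concerns an arbitrary locally finite flag complex with such a level
  function. Each vertex outside the lowest levels is pushed linearly onto the barycentre of the
  set of all lower vertices that dominate it. Since this set is defined without choices, the push commutes with the symmetries of
  the complex and therefore preserves their fixed points, even though a symmetry fixing \<open>v\<close> may
  permute the vertices dominating \<open>v\<close>. There are infinitely many levels, and the highest must be
  pushed first, so level \<open>n\<close> is pushed during the time interval from \<open>1/(n+1)\<close> to \<open>1/n\<close>. A point
  involves only finitely many levels, so near time \<open>0\<close> it does not move, and local finiteness makes
  the whole motion continuous. At time \<open>1\<close> everything lies in the simplex spanned by the lowest
  levels, where a straight line to the barycentre finishes the contraction.
\<close>

section \<open>Word metrics\<close>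

locale word_metric = group G for G (structure) +
  fixes S :: "'a set"
  assumes S_finite: "finite S" and S_carrier: "S \<subseteq> carrier G"
    and S_sym: "set_inv S = S" and S_gen: "generate G S = carrier G"
begin

abbreviation dist_S :: "'a \<Rightarrow> 'a \<Rightarrow> nat" where
  "dist_S \<equiv> word_dist G S"

lemma word_product_simps [simp]:
  "word_product G [] = \<one>" "word_product G (s # ss) = s \<otimes> word_product G ss"
  by (simp_all add: word_product_def)

lemma word_product_closed [simp]: "set ss \<subseteq> S \<Longrightarrow> word_product G ss \<in> carrier G"
  using S_carrier by (induction ss) auto

lemma word_product_append:
  "set ss \<subseteq> S \<Longrightarrow> set ts \<subseteq> S \<Longrightarrow>
    word_product G (ss @ ts) = word_product G ss \<otimes> word_product G ts"
proof (induction ss)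
  case (Cons s ss)
  then show ?case using S_carrier by (auto simp: m_assoc subset_iff)
qed simp

lemma inv_S: "s \<in> S \<Longrightarrow> inv s \<in> S"
  using S_sym unfolding SET_INV_def by blast

lemma word_product_inv:
  assumes "set ss \<subseteq> S"
  shows "\<exists>ts. length ts = length ss \<and> set ts \<subseteq> S \<and> word_product G ts = inv (word_product G ss)"
  using assms
proof (induction ss)
  case (Cons s ss)
  then obtain ts where ts: "length ts = length ss" "set ts \<subseteq> S"
    "word_product G ts = inv (word_product G ss)" by auto
  have s: "s \<in> carrier G" "inv s \<in> S" "inv s \<in> carrier G"
    using Cons.prems S_carrier inv_S by auto
  have "word_product G (ts @ [inv s]) = inv (word_product G (s # ss))"
    using ts s Cons.prems by (simp add: word_product_append inv_mult_group)
  then show ?case using ts s by (intro exI[of _ "ts @ [inv s]"]) auto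
qed simp

lemma word_exists:
  assumes "g \<in> carrier G"
  shows "\<exists>ss. set ss \<subseteq> S \<and> word_product G ss = g"
proof -
  have "g \<in> generate G S" using assms S_gen by simp
  then show ?thesis
  proof induction
    case one
    then show ?case by (intro exI[of _ "[]"]) simp
  next
    case (incl s)
    then show ?case using S_carrier by (intro exI[of _ "[s]"]) auto
  next
    case (inv s)
    then show ?case using S_carrier inv_S by (intro exI[of _ "[inv s]"]) auto
  next
    case (eng g h)
    then obtain ss ts where "set ss \<subseteq> S" "word_product G ss = g" "set ts \<subseteq> S" "word_product G ts = h"
      by blast
    then show ?case by (intro exI[of _ "ss @ ts"]) (simp add: word_product_append)
  qed
qed

lemma word_dist_attained:
  assumes "x \<in> carrier G" "y \<in> carrier G"
  obtains ss where "length ss = dist_S x y" "set ss \<subseteq> S" "y = x \<otimes> word_product G ss"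
proof -
  obtain ts where "set ts \<subseteq> S" "word_product G ts = inv x \<otimes> y"
    using word_exists[of "inv x \<otimes> y"] assms by auto
  then have "\<exists>n ss. length ss = n \<and> set ss \<subseteq> S \<and> word_product G ss = inv x \<otimes> y" by blast
  from LeastI_ex[OF this] obtain ss
    where "length ss = dist_S x y" "set ss \<subseteq> S" "word_product G ss = inv x \<otimes> y"
    unfolding word_dist_def by blast
  then have "length ss = dist_S x y" "set ss \<subseteq> S" "y = x \<otimes> word_product G ss"
    using assms by (simp_all add: m_assoc[symmetric])
  then show ?thesis by (rule that)
qed

lemma word_dist_le:
  assumes "x \<in> carrier G" "set ss \<subseteq> S"
  shows "dist_S x (x \<otimes> word_product G ss) \<le> length ss"
  unfolding word_dist_def
  by (rule Least_le) (use assms in \<open>auto simp: m_assoc[symmetric]\<close>)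

lemma word_dist_self [simp]: "x \<in> carrier G \<Longrightarrow> dist_S x x = 0"
  using word_dist_le[of x "[]"] by simp

lemma word_dist_commute:
  assumes "x \<in> carrier G" "y \<in> carrier G"
  shows "dist_S x y = dist_S y x"
proof -
  have le: "dist_S y x \<le> dist_S x y" if x: "x \<in> carrier G" and y: "y \<in> carrier G" for x y
  proof -
    obtain ss where ss: "length ss = dist_S x y" "set ss \<subseteq> S" "y = x \<otimes> word_product G ss"
      using word_dist_attained x y by blast
    obtain ts where ts: "length ts = length ss" "set ts \<subseteq> S"
        "word_product G ts = inv (word_product G ss)"
      using word_product_inv ss by blast
    have "x = y \<otimes> word_product G ts" using ss ts x by (simp add: m_assoc)
    then show ?thesis using word_dist_le[OF y ts(2)] ts(1) ss(1) by simp
  qed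
  show ?thesis using le assms by (simp add: order_antisym)
qed

lemma word_dist_triangle:
  assumes "x \<in> carrier G" "y \<in> carrier G" "z \<in> carrier G"
  shows "dist_S x z \<le> dist_S x y + dist_S y z"
proof -
  obtain ss where ss: "length ss = dist_S x y" "set ss \<subseteq> S" "y = x \<otimes> word_product G ss"
    using word_dist_attained assms by blast
  obtain ts where ts: "length ts = dist_S y z" "set ts \<subseteq> S" "z = y \<otimes> word_product G ts"
    using word_dist_attained assms by blast
  have "z = x \<otimes> word_product G (ss @ ts)"
    using ss ts assms by (simp add: word_product_append m_assoc)
  then show ?thesis using word_dist_le[of x "ss @ ts"] ss(1,2) ts(1,2) assms by simp
qed

lemma word_dist_mult_left:
  assumes "g \<in> carrier G" "x \<in> carrier G" "y \<in> carrier G"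
  shows "dist_S (g \<otimes> x) (g \<otimes> y) = dist_S x y"
proof -
  have "inv (g \<otimes> x) \<otimes> (g \<otimes> y) = inv x \<otimes> (inv g \<otimes> (g \<otimes> y))"
    using assms by (simp add: inv_mult_group m_assoc)
  also have "inv g \<otimes> (g \<otimes> y) = y" using assms by (simp flip: m_assoc)
  finally show ?thesis unfolding word_dist_def by simp
qed

lemma word_dist_interpolate:
  assumes x: "x \<in> carrier G" and y: "y \<in> carrier G" and k: "k \<le> dist_S x y"
  obtains w where "w \<in> carrier G" "dist_S x w \<le> k" "dist_S w y \<le> dist_S x y - k"
proof -
  obtain ss where ss: "length ss = dist_S x y" "set ss \<subseteq> S" "y = x \<otimes> word_product G ss"
    using word_dist_attained x y by blast
  have sub: "set (take k ss) \<subseteq> S" "set (drop k ss) \<subseteq> S"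
    using ss(2) set_take_subset[of k ss] set_drop_subset[of k ss] by auto
  let ?w = "x \<otimes> word_product G (take k ss)"
  have w: "?w \<in> carrier G" using x sub by simp
  have y_eq: "y = ?w \<otimes> word_product G (drop k ss)"
    using ss(3) x sub word_product_append[OF sub] by (simp add: m_assoc)
  have "dist_S ?w y \<le> length (drop k ss)"
    by (subst y_eq) (rule word_dist_le[OF w sub(2)])
  then have "dist_S ?w y \<le> dist_S x y - k" by (simp only: length_drop ss(1))
  moreover have "dist_S x ?w \<le> k"
    using word_dist_le[OF x sub(1)] by simp
  ultimately show ?thesis using that w by blast
qed

lemma finite_word_ball:
  assumes "x \<in> carrier G"
  shows "finite {y \<in> carrier G. dist_S x y \<le> n}"
proof (rule finite_subset)
  show "{y \<in> carrier G. dist_S x y \<le> n} \<subseteq>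
      (\<lambda>ss. x \<otimes> word_product G ss) ` {ss. set ss \<subseteq> S \<and> length ss \<le> n}"
  proof
    fix y assume "y \<in> {y \<in> carrier G. dist_S x y \<le> n}"
    then have y: "y \<in> carrier G" "dist_S x y \<le> n" by auto
    obtain ss where "length ss = dist_S x y" "set ss \<subseteq> S" "y = x \<otimes> word_product G ss"
      by (rule word_dist_attained[OF assms y(1)])
    with y(2) have "length ss \<le> n" "set ss \<subseteq> S" "y = x \<otimes> word_product G ss" by simp_all
    then show "y \<in> (\<lambda>ss. x \<otimes> word_product G ss) ` {ss. set ss \<subseteq> S \<and> length ss \<le> n}" by blast
  qed
  show "finite ((\<lambda>ss. x \<otimes> word_product G ss) ` {ss. set ss \<subseteq> S \<and> length ss \<le> n})"
    using finite_lists_length_le[OF S_finite] by blast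
qed

end

section \<open>Locally finite realizations\<close>

text \<open>
  Near a point with a nonzero coordinate at \<open>v\<close>, every point lies in one of the finitely many
  simplices containing \<open>v\<close>, so the weak topology imposes only finitely many conditions there. For a
  locally finite complex, continuity in the weak topology can thus be checked coordinate by
  coordinate.
\<close>

lemma realization_locally_finite:
  fixes K :: "'v set set"
  assumes fin: "\<And>v. finite {\<sigma> \<in> K. v \<in> \<sigma>}" and ne: "{} \<notin> K"
  shows "realization K = top_of_set (realization_points K)"
proof (rule topology_eq[THEN iffD2], intro allI iffI)
  fix U
  assume U: "openin (top_of_set (realization_points K)) U"
  have "openin (top_of_set (closed_simplex K \<sigma>)) (U \<inter> closed_simplex K \<sigma>)" for \<sigma>
  proof -
    obtain W where "open W" "U = realization_points K \<inter> W" using U by (auto simp: openin_open)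
    then have "U \<inter> closed_simplex K \<sigma> = closed_simplex K \<sigma> \<inter> W"
      by (auto simp: closed_simplex_def)
    then show ?thesis using \<open>open W\<close> by (auto simp: openin_open)
  qed
  then show "openin (realization K) U"
    using openin_imp_subset[OF U] by (auto simp: openin_realization)
next
  fix U
  assume "openin (realization K) U"
  then have sub: "U \<subseteq> realization_points K"
    and op: "\<And>\<sigma>. \<sigma> \<in> K \<Longrightarrow> openin (top_of_set (closed_simplex K \<sigma>)) (U \<inter> closed_simplex K \<sigma>)"
    by (auto simp: openin_realization)
  have "\<exists>W. \<forall>\<sigma>\<in>K. open (W \<sigma>) \<and> U \<inter> closed_simplex K \<sigma> = closed_simplex K \<sigma> \<inter> W \<sigma>"
    using op by (simp add: openin_open) metis
  then obtain W where W: "\<And>\<sigma>. \<sigma> \<in> K \<Longrightarrow> open (W \<sigma>)"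
    "\<And>\<sigma>. \<sigma> \<in> K \<Longrightarrow> U \<inter> closed_simplex K \<sigma> = closed_simplex K \<sigma> \<inter> W \<sigma>"
    by blast
  show "openin (top_of_set (realization_points K)) U"
  proof (subst openin_subopen, intro ballI)
    fix x assume x: "x \<in> U"
    then have xK: "x \<in> realization_points K" using sub by blast
    then have "supp x \<in> K" by (simp add: realization_points_def)
    then obtain v where "v \<in> supp x" using ne by fastforce
    then have v: "x v \<noteq> 0" by (simp add: supp_def)
    define L where "L = {\<sigma> \<in> K. v \<in> \<sigma> \<and> supp x \<subseteq> \<sigma>}"
    have L: "finite L" using fin[of v] by (rule rev_finite_subset) (auto simp: L_def)
    define N where "N = (\<Inter>u\<in>supp x. {t. t u \<noteq> 0}) \<inter> (\<Inter>\<sigma>\<in>L. W \<sigma>)"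
    have coord: "open {t::'v \<Rightarrow> real. t u \<noteq> 0}" for u
      by (intro open_Collect_neq continuous_intros continuous_on_product_coordinates)
    have fx: "finite (supp x)"
      using xK by (auto simp: realization_points_def intro: sum.infinite ccontr)
    have "open N"
      unfolding N_def using L W(1) fx coord by (intro open_Int open_INT) (auto simp: L_def)
    moreover have "x \<in> N"
      unfolding N_def using W(2) x xK by (auto simp: L_def closed_simplex_def supp_def)
    moreover have "realization_points K \<inter> N \<subseteq> U"
    proof
      fix t assume t: "t \<in> realization_points K \<inter> N"
      then have "supp t \<in> L"
        using v by (auto simp: L_def N_def realization_points_def supp_def)
      moreover have "t \<in> closed_simplex K (supp t)"
        using t by (simp add: closed_simplex_def)
      ultimately show "t \<in> U" using t W(2)[of "supp t"] by (auto simp: L_def N_def)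
    qed
    ultimately show "\<exists>T. openin (top_of_set (realization_points K)) T \<and> x \<in> T \<and> T \<subseteq> U"
      using xK by (intro exI[of _ "realization_points K \<inter> N"]) auto
  qed
qed

lemma realization_map_fixed_iff:
  assumes f: "bij_betw f V V" and t: "supp t \<subseteq> V"
  shows "realization_map f t = t \<longleftrightarrow> (\<forall>v\<in>V. t (f v) = t v)"
proof -
  have val: "realization_map f t (f v) = t v" if "v \<in> V" for v
  proof -
    have "{u \<in> supp t. f u = f v} = (if t v = 0 then {} else {v})"
      using that t bij_betw_imp_inj_on[OF f] by (auto simp: supp_def inj_on_def)
    then show ?thesis by (simp add: realization_map_def)
  qed
  have outside: "realization_map f t w = t w" if "w \<notin> V" for w
  proof -
    have "{u \<in> supp t. f u = w} = {}" using that t bij_betwE[OF f] by auto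
    moreover have "t w = 0" using that t by (auto simp: supp_def)
    ultimately show ?thesis unfolding realization_map_def by (simp only: sum.empty)
  qed
  have "realization_map f t = t \<longleftrightarrow> (\<forall>w\<in>V. realization_map f t w = t w)"
    using outside by (auto simp: fun_eq_iff)
  also have "\<dots> \<longleftrightarrow> (\<forall>w\<in>f ` V. realization_map f t w = t w)"
    using bij_betw_imp_surj_on[OF f] by simp
  also have "\<dots> \<longleftrightarrow> (\<forall>v\<in>V. t (f v) = t v)" using val by auto
  finally show ?thesis .
qed

section \<open>Collapsing a flag complex level by level\<close>

text \<open>
  The edges are given by \<open>R\<close> and the levels by \<open>\<rho>\<close>; the core, formed by the vertices of level at
  most \<open>m\<close>, spans a simplex, and \<open>A\<close> is any set of symmetries. Domination is required only among
  the vertices of level at most \<open>\<rho> v\<close>, because all higher vertices are gone by the time \<open>v\<close> is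
  pushed.
\<close>

locale dominated_flag_complex =
  fixes V :: "'v set" and R :: "'v \<Rightarrow> 'v \<Rightarrow> bool" and \<rho> :: "'v \<Rightarrow> nat" and m :: nat
    and A :: "('v \<Rightarrow> 'v) set"
  assumes R_refl: "v \<in> V \<Longrightarrow> R v v"
    and R_sym: "u \<in> V \<Longrightarrow> v \<in> V \<Longrightarrow> R u v \<Longrightarrow> R v u"
    and locally_finite: "v \<in> V \<Longrightarrow> finite {w \<in> V. R v w}"
    and core_clique: "u \<in> V \<Longrightarrow> v \<in> V \<Longrightarrow> \<rho> u \<le> m \<Longrightarrow> \<rho> v \<le> m \<Longrightarrow> R u v"
    and core_nonempty: "\<exists>v\<in>V. \<rho> v \<le> m"
    and dominated: "v \<in> V \<Longrightarrow> m < \<rho> v \<Longrightarrow>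
      \<exists>w\<in>V. \<rho> w < \<rho> v \<and> (\<forall>y\<in>V. \<rho> y \<le> \<rho> v \<longrightarrow> R v y \<longrightarrow> R w y)"
    and action_bij: "f \<in> A \<Longrightarrow> bij_betw f V V"
    and action_level: "f \<in> A \<Longrightarrow> v \<in> V \<Longrightarrow> \<rho> (f v) = \<rho> v"
    and action_edge: "f \<in> A \<Longrightarrow> u \<in> V \<Longrightarrow> v \<in> V \<Longrightarrow> R (f u) (f v) = R u v"
begin

definition flag_complex :: "'v set set" where
  "flag_complex = {\<sigma>. finite \<sigma> \<and> \<sigma> \<noteq> {} \<and> \<sigma> \<subseteq> V \<and> (\<forall>u\<in>\<sigma>. \<forall>v\<in>\<sigma>. R u v)}"

definition fixed_points :: "('v \<Rightarrow> real) set" where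
  "fixed_points = {t \<in> realization_points flag_complex. \<forall>f\<in>A. realization_map f t = t}"

text \<open>
  All dominating vertices of lower level are taken together, since singling out one of them would
  destroy the symmetry.
\<close>

definition dominators :: "'v \<Rightarrow> 'v set" where
  "dominators v = {w \<in> V. \<rho> w < \<rho> v \<and> (\<forall>y\<in>V. \<rho> y \<le> \<rho> v \<longrightarrow> R v y \<longrightarrow> R w y)}"

text \<open>
  The proportion of the push of level \<open>n\<close> that is done at time \<open>\<tau>\<close>: on the interval from \<open>1/(n+1)\<close>
  to \<open>1/n\<close> it rises linearly from \<open>0\<close> to \<open>1\<close>. These intervals have disjoint interiors and
  accumulate at \<open>0\<close>, which places the higher levels earlier.
\<close>

definition progress :: "nat \<Rightarrow> real \<Rightarrow> real" where
  "progress n \<tau> = (if n \<le> m then 0 else max 0 (min 1 (real n * ((real n + 1) * \<tau> - 1))))"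

text \<open>
  The barycentric coordinate at \<open>w\<close> of the position of the vertex \<open>v\<close> at time \<open>\<tau>\<close>. The part
  of its mass that has left \<open>v\<close> is shared equally among its dominators and follows their own motion; the
  recursion ends because dominators have lower level.
\<close>

function push :: "real \<Rightarrow> 'v \<Rightarrow> 'v \<Rightarrow> real" where
  "push \<tau> v w = (1 - progress (\<rho> v) \<tau>) * (if w = v then 1 else 0) +
     progress (\<rho> v) \<tau> * ((\<Sum>u\<in>dominators v. push \<tau> u w) / card (dominators v))"
  by pat_completeness auto
termination
  by (relation "Wellfounded.measure (\<lambda>(\<tau>, v, w). \<rho> v)") (auto simp: dominators_def)

declare push.simps [simp del]

text \<open>The motion of the vertices, extended affinely to every simplex.\<close>

definition spread :: "real \<Rightarrow> ('v \<Rightarrow> real) \<Rightarrow> 'v \<Rightarrow> real" where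
  "spread \<tau> t w = (\<Sum>v\<in>supp t. t v * push \<tau> v w)"

lemma dominators_subset: "dominators v \<subseteq> V"
  and dominators_level: "u \<in> dominators v \<Longrightarrow> \<rho> u < \<rho> v"
  and dominators_edge: "u \<in> dominators v \<Longrightarrow> y \<in> V \<Longrightarrow> \<rho> y \<le> \<rho> v \<Longrightarrow> R v y \<Longrightarrow> R u y"
  by (auto simp: dominators_def)

lemma finite_dominators:
  assumes "v \<in> V"
  shows "finite (dominators v)"
  using locally_finite[OF assms]
  by (rule rev_finite_subset) (use assms in \<open>auto simp: dominators_def intro: R_sym R_refl\<close>)

lemma dominators_nonempty: "v \<in> V \<Longrightarrow> m < \<rho> v \<Longrightarrow> dominators v \<noteq> {}"
  using dominated[of v] unfolding dominators_def by blast

lemma dominators_action: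
  assumes "f \<in> A" "v \<in> V"
  shows "dominators (f v) = f ` dominators v"
proof -
  have V: "V = f ` V" using action_bij[OF assms(1)] by (simp add: bij_betw_def)
  have fV: "\<And>u. u \<in> V \<Longrightarrow> f u \<in> V" using V by blast
  have "f u \<in> dominators (f v) \<longleftrightarrow> u \<in> dominators v" if "u \<in> V" for u
  proof -
    have "(\<forall>y\<in>f ` V. \<rho> y \<le> \<rho> (f v) \<longrightarrow> R (f v) y \<longrightarrow> R (f u) y) \<longleftrightarrow>
        (\<forall>y\<in>V. \<rho> y \<le> \<rho> v \<longrightarrow> R v y \<longrightarrow> R u y)"
      using assms that by (simp add: action_level action_edge)
    then show ?thesis
      using that assms fV V[symmetric] by (simp add: dominators_def action_level)
  qed
  moreover have "dominators (f v) \<subseteq> f ` V" using dominators_subset V by blast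
  ultimately show ?thesis using dominators_subset by blast
qed

lemma progress_bounds: "0 \<le> progress n \<tau>" "progress n \<tau> \<le> 1"
  by (auto simp: progress_def)

lemma progress_core: "n \<le> m \<Longrightarrow> progress n \<tau> = 0"
  by (simp add: progress_def)

lemma progress_0 [simp]: "progress n 0 = 0"
  by (simp add: progress_def)

lemma progress_1:
  assumes "m < n" shows "progress n 1 = 1"
proof -
  have "real n * real n \<ge> 1 * 1" using assms by (intro mult_mono) auto
  then show ?thesis using assms by (simp add: progress_def)
qed

text \<open>At any time, at most one level is in transit, and all levels above it have been emptied.\<close>

lemma progress_sequential:
  assumes "n < n'" "progress n \<tau> \<noteq> 0"
  shows "progress n' \<tau> = 1"
proof -
  have n: "m < n" "real n * ((real n + 1) * \<tau> - 1) > 0"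
    using assms(2) by (auto simp: progress_def split: if_splits)
  then have pos: "(real n + 1) * \<tau> > 1" by (auto simp: zero_less_mult_iff)
  then have "\<tau> > 0" by (smt (verit) of_nat_0_le_iff mult_nonneg_nonpos)
  then have "(real n + 1) * \<tau> \<le> real n' * \<tau>"
    using assms(1) by (intro mult_right_mono) auto
  then have "(real n' + 1) * 1 \<le> (real n' + 1) * (real n' * \<tau>)"
    using pos by (intro mult_left_mono) auto
  then have "real n' * ((real n' + 1) * \<tau> - 1) \<ge> 1" by (simp add: algebra_simps)
  then show ?thesis using n assms(1) by (simp add: progress_def)
qed

lemma continuous_progress: "continuous_on T (progress n)"
  unfolding progress_def by (cases "n \<le> m") (auto intro!: continuous_intros)

lemma push_nonneg: "0 \<le> push \<tau> v w"
proof (induction v rule: measure_induct_rule[of \<rho>])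
  case (less v)
  have "0 \<le> (\<Sum>u\<in>dominators v. push \<tau> u w)"
    using less dominators_level by (intro sum_nonneg) blast
  then have "0 \<le> progress (\<rho> v) \<tau> * ((\<Sum>u\<in>dominators v. push \<tau> u w) / card (dominators v))"
    using progress_bounds by (intro mult_nonneg_nonneg divide_nonneg_nonneg) auto
  then show ?case
    using progress_bounds[of "\<rho> v" \<tau>] by (subst push.simps) (simp del: times_divide_eq_right)
qed

lemma push_start: "push 0 v w = (if w = v then 1 else 0)"
  by (subst push.simps) simp

lemma continuous_push: "continuous_on T (\<lambda>\<tau>. push \<tau> v w)"
proof (induction v rule: measure_induct_rule[of \<rho>])
  case (less v)
  have "continuous_on T (\<lambda>\<tau>. push \<tau> u w)" if "u \<in> dominators v" for u
    using less dominators_level that by blast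
  then show ?case
    by (subst push.simps, unfold divide_inverse) (intro continuous_intros continuous_progress)
qed

lemma push_cases:
  assumes "v \<in> V" "push \<tau> v w \<noteq> 0"
  obtains (stay) "w = v" "progress (\<rho> v) \<tau> \<noteq> 1"
  | (move) u where "u \<in> dominators v" "push \<tau> u w \<noteq> 0" "progress (\<rho> v) \<tau> \<noteq> 0"
proof (cases "w = v \<and> progress (\<rho> v) \<tau> \<noteq> 1")
  case False
  then have "progress (\<rho> v) \<tau> * ((\<Sum>u\<in>dominators v. push \<tau> u w) / card (dominators v)) \<noteq> 0"
    using assms(2) by (subst (asm) push.simps) (auto split: if_splits)
  then have "progress (\<rho> v) \<tau> \<noteq> 0" "(\<Sum>u\<in>dominators v. push \<tau> u w) \<noteq> 0" by auto
  then show ?thesis using move by (meson sum.neutral)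
qed (use stay in blast)

lemma push_carrier: "v \<in> V \<Longrightarrow> push \<tau> v w \<noteq> 0 \<Longrightarrow> w \<in> V"
proof (induction v rule: measure_induct_rule[of \<rho>])
  case (less v)
  from less.prems show ?case
    by (cases rule: push_cases) (use less dominators_level dominators_subset in blast)+
qed

text \<open>At time \<open>1\<close> the push of every level above \<open>m\<close> is complete, so only the core carries mass.\<close>

lemma push_end: "v \<in> V \<Longrightarrow> push 1 v w \<noteq> 0 \<Longrightarrow> \<rho> w \<le> m"
proof (induction v rule: measure_induct_rule[of \<rho>])
  case (less v)
  from less.prems show ?case
  proof (cases rule: push_cases)
    case stay
    then show ?thesis using progress_1[of "\<rho> v"] by force
  next
    case (move u)
    then show ?thesis using less.IH[of u] dominators_level dominators_subset by blast
  qed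
qed

lemma finite_supp_push: "v \<in> V \<Longrightarrow> finite (supp (push \<tau> v))"
proof (induction v rule: measure_induct_rule[of \<rho>])
  case (less v)
  have "finite (insert v (\<Union>u\<in>dominators v. supp (push \<tau> u)))"
    using less.IH dominators_level dominators_subset finite_dominators[OF less.prems] by blast
  moreover have "supp (push \<tau> v) \<subseteq> insert v (\<Union>u\<in>dominators v. supp (push \<tau> u))"
    using push_cases[OF less.prems] by (fastforce simp: supp_def)
  ultimately show ?case by (rule rev_finite_subset)
qed

lemma sum_push:
  "v \<in> V \<Longrightarrow> finite B \<Longrightarrow> supp (push \<tau> v) \<subseteq> B \<Longrightarrow> (\<Sum>w\<in>B. push \<tau> v w) = 1"
proof (induction v arbitrary: B rule: measure_induct_rule[of \<rho>])
  case (less v)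
  let ?p = "progress (\<rho> v) \<tau>" and ?c = "real (card (dominators v))"
  define C where "C = B \<union> insert v (\<Union>u\<in>dominators v. supp (push \<tau> u))"
  have fin: "finite C"
    unfolding C_def
    using less.prems(1,2) finite_dominators finite_supp_push dominators_subset by blast
  have "(\<Sum>w\<in>B. push \<tau> v w) = (\<Sum>w\<in>C. push \<tau> v w)"
    by (rule sum.mono_neutral_left) (use fin less.prems in \<open>auto simp: C_def supp_def\<close>)
  also have "\<dots> = (\<Sum>w\<in>C. (1 - ?p) * (if w = v then 1 else 0)) +
      (\<Sum>w\<in>C. ?p * ((\<Sum>u\<in>dominators v. push \<tau> u w) / ?c))"
    by (subst push.simps) (rule sum.distrib)
  also have "\<dots> = (1 - ?p) * (\<Sum>w\<in>C. if w = v then 1 else 0) +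
      ?p * ((\<Sum>w\<in>C. \<Sum>u\<in>dominators v. push \<tau> u w) / ?c)"
    by (simp add: sum_distrib_left sum_divide_distrib)
  also have "(\<Sum>w\<in>C. \<Sum>u\<in>dominators v. push \<tau> u w) = (\<Sum>u\<in>dominators v. \<Sum>w\<in>C. push \<tau> u w)"
    by (rule sum.swap)
  also have "\<dots> = (\<Sum>u\<in>dominators v. 1)"
  proof (rule sum.cong[OF refl])
    fix u assume "u \<in> dominators v"
    then show "(\<Sum>w\<in>C. push \<tau> u w) = 1"
      using less.IH[of u C] fin dominators_level dominators_subset by (auto simp: C_def)
  qed
  also have "(\<Sum>w\<in>C. if w = v then 1 else 0) = (1::real)"
    using fin by (simp add: C_def)
  finally have eq: "(\<Sum>w\<in>B. push \<tau> v w) = (1 - ?p) + ?p * (?c / ?c)" by simp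
  show ?case
  proof (cases "m < \<rho> v")
    case True
    then have "?c \<noteq> 0"
      using dominators_nonempty finite_dominators less.prems(1) by simp
    then show ?thesis using eq by simp
  next
    case False
    then show ?thesis using eq by (simp add: progress_core)
  qed
qed

lemma push_action:
  assumes f: "f \<in> A"
  shows "v \<in> V \<Longrightarrow> w \<in> V \<Longrightarrow> push \<tau> (f v) (f w) = push \<tau> v w"
proof (induction v rule: measure_induct_rule[of \<rho>])
  case (less v)
  have inj: "inj_on f V" using action_bij[OF f] by (rule bij_betw_imp_inj_on)
  then have injD: "inj_on f (dominators v)" using dominators_subset inj_on_subset by blast
  have "(\<Sum>u\<in>dominators (f v). push \<tau> u (f w)) = (\<Sum>u\<in>dominators v. push \<tau> (f u) (f w))"
    using injD by (simp add: dominators_action f less.prems sum.reindex)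
  also have "\<dots> = (\<Sum>u\<in>dominators v. push \<tau> u w)"
  proof (rule sum.cong[OF refl])
    fix u assume "u \<in> dominators v"
    then show "push \<tau> (f u) (f w) = push \<tau> u w"
      using less.IH less.prems(2) dominators_level dominators_subset by blast
  qed
  finally have sums: "(\<Sum>u\<in>dominators (f v). push \<tau> u (f w)) = (\<Sum>u\<in>dominators v. push \<tau> u w)" .
  have cards: "card (dominators (f v)) = card (dominators v)"
    using injD by (simp add: dominators_action f less.prems card_image)
  have "f w = f v \<longleftrightarrow> w = v" using inj less.prems by (auto simp: inj_on_def)
  then show ?case
    by (subst (1 2) push.simps) (simp add: sums cards action_level f less.prems)
qed

text \<open>
  This is what keeps the motion inside the complex: in a flag complex it is enough that adjacent
  vertices have adjacent positions. In the induction, the higher of two adjacent vertices may be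
  replaced by a dominator, which is still adjacent to the lower one. If instead the higher vertex
  still carries mass, all lower levels are at rest, so the other vertex is either at its initial
  position or on the same level; in the latter case domination applies with the roles exchanged.
\<close>

lemma push_edge:
  "v \<in> V \<Longrightarrow> v' \<in> V \<Longrightarrow> R v v' \<Longrightarrow> push \<tau> v w \<noteq> 0 \<Longrightarrow> push \<tau> v' w' \<noteq> 0 \<Longrightarrow> R w w'"
proof (induction "\<rho> v + \<rho> v'" arbitrary: v v' w w' rule: less_induct)
  case less
  have wlog: "R w w'"
    if IH: "\<And>u u' w w'. \<rho> u + \<rho> u' < \<rho> v + \<rho> v' \<Longrightarrow> u \<in> V \<Longrightarrow> u' \<in> V \<Longrightarrow> R u u' \<Longrightarrow>
        push \<tau> u w \<noteq> 0 \<Longrightarrow> push \<tau> u' w' \<noteq> 0 \<Longrightarrow> R w w'"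
      and level: "\<rho> v' \<le> \<rho> v" and v: "v \<in> V" "v' \<in> V" "R v v'"
      and w: "push \<tau> v w \<noteq> 0" "push \<tau> v' w' \<noteq> 0"
    for v v' w w'
    using v(1) w(1)
  proof (cases rule: push_cases)
    case (move u)
    then have "R u v'" using dominators_edge v level by blast
    then show ?thesis
      using IH[of u v'] move dominators_level dominators_subset v w by fastforce
  next
    case stay
    note stay_v = this
    show ?thesis using v(2) w(2)
    proof (cases rule: push_cases)
      case stay
      then show ?thesis using stay_v v by simp
    next
      case (move u')
      have "\<rho> v' = \<rho> v"
        using progress_sequential[of "\<rho> v'" "\<rho> v" \<tau>] move(3) stay_v(2) level by force
      then have "R u' v" using dominators_edge[OF move(1) v(1)] R_sym v by simp
      then have "R v u'" using R_sym v(1) move(1) dominators_subset by blast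
      then show ?thesis
        using IH[of v u' w w'] move dominators_level[of u' v'] dominators_subset v w by fastforce
    qed
  qed
  show ?case
  proof (cases "\<rho> v' \<le> \<rho> v")
    case True
    show ?thesis
      by (rule wlog[OF _ True less.prems]) (use less.hyps in blast)
  next
    case False
    then have le: "\<rho> v \<le> \<rho> v'" by simp
    have "R v' v" using R_sym less.prems by blast
    then have "R w' w"
      by (intro wlog[OF _ le less.prems(2,1) _ less.prems(5,4)])
         (use less.hyps in \<open>simp_all add: add.commute\<close>)
    then show ?thesis using R_sym push_carrier less.prems by blast
  qed
qed

lemma flag_pointD:
  assumes "t \<in> realization_points flag_complex"
  shows "0 \<le> t v" "finite (supp t)" "supp t \<subseteq> V" "(\<Sum>v\<in>supp t. t v) = 1"
    and "u \<in> supp t \<Longrightarrow> v \<in> supp t \<Longrightarrow> R u v"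
  using assms by (auto simp: realization_points_def flag_complex_def)

lemma flag_pointI:
  assumes "\<And>v. 0 \<le> t v" "finite B" "supp t \<subseteq> B" "(\<Sum>v\<in>B. t v) = 1" "supp t \<subseteq> V"
    and "\<And>u v. u \<in> supp t \<Longrightarrow> v \<in> supp t \<Longrightarrow> R u v"
  shows "t \<in> realization_points flag_complex"
proof -
  have "(\<Sum>v\<in>supp t. t v) = (\<Sum>v\<in>B. t v)"
    by (rule sum.mono_neutral_left) (use assms(2,3) in \<open>auto simp: supp_def\<close>)
  then have "(\<Sum>v\<in>supp t. t v) = 1" using assms by simp
  moreover from this have "supp t \<noteq> {}" by force
  ultimately show ?thesis
    using assms finite_subset[OF assms(3,2)] by (auto simp: realization_points_def flag_complex_def)
qed

lemma supp_spread:
  assumes "w \<in> supp (spread \<tau> t)"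
  obtains v where "v \<in> supp t" "push \<tau> v w \<noteq> 0"
proof -
  have "(\<Sum>v\<in>supp t. t v * push \<tau> v w) \<noteq> 0" using assms by (simp add: supp_def spread_def)
  then obtain v where "v \<in> supp t" "t v * push \<tau> v w \<noteq> 0"
    by (rule sum.not_neutral_contains_not_neutral)
  then show ?thesis using that by auto
qed

lemma spread_point:
  assumes t: "t \<in> realization_points flag_complex"
  shows "spread \<tau> t \<in> realization_points flag_complex"
proof (rule flag_pointI)
  let ?B = "\<Union>v\<in>supp t. supp (push \<tau> v)"
  note t = flag_pointD[OF t]
  have V: "v \<in> V" if "v \<in> supp t" for v using that t(3) by blast
  show "0 \<le> spread \<tau> t w" for w
    unfolding spread_def using t(1) push_nonneg by (intro sum_nonneg mult_nonneg_nonneg) auto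
  show B: "finite ?B" using t(2) finite_supp_push V by blast
  show "supp (spread \<tau> t) \<subseteq> ?B"
    by (auto elim!: supp_spread) (auto simp: supp_def)
  show "supp (spread \<tau> t) \<subseteq> V"
    by (auto elim!: supp_spread dest: V push_carrier)
  have "(\<Sum>w\<in>?B. spread \<tau> t w) = (\<Sum>v\<in>supp t. \<Sum>w\<in>?B. t v * push \<tau> v w)"
    unfolding spread_def by (rule sum.swap)
  also have "\<dots> = (\<Sum>v\<in>supp t. t v * (\<Sum>w\<in>?B. push \<tau> v w))"
    by (simp add: sum_distrib_left)
  also have "\<dots> = (\<Sum>v\<in>supp t. t v)"
  proof (rule sum.cong[OF refl])
    fix v assume "v \<in> supp t"
    then show "t v * (\<Sum>w\<in>?B. push \<tau> v w) = t v" using sum_push[OF V B] by fastforce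
  qed
  finally show "(\<Sum>w\<in>?B. spread \<tau> t w) = 1" using t(4) by simp
  fix w w' assume "w \<in> supp (spread \<tau> t)" "w' \<in> supp (spread \<tau> t)"
  then obtain v v' where "v \<in> supp t" "push \<tau> v w \<noteq> 0" "v' \<in> supp t" "push \<tau> v' w' \<noteq> 0"
    by (elim supp_spread)
  then show "R w w'" using push_edge t(5) V by blast
qed

lemma fixed_points_iff:
  "t \<in> fixed_points \<longleftrightarrow>
    t \<in> realization_points flag_complex \<and> (\<forall>f\<in>A. \<forall>v\<in>V. t (f v) = t v)"
  using realization_map_fixed_iff[OF action_bij flag_pointD(3)] unfolding fixed_points_def by blast

lemma spread_fixed:
  assumes t: "t \<in> fixed_points"
  shows "spread \<tau> t \<in> fixed_points"
proof -
  have point: "t \<in> realization_points flag_complex" using t by (simp add: fixed_points_iff)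
  note tV = flag_pointD(3)[OF point]
  have "spread \<tau> t (f w) = spread \<tau> t w" if f: "f \<in> A" and w: "w \<in> V" for f w
  proof -
    have bij: "bij_betw f V V" using action_bij[OF f] .
    have inv: "t (f v) = t v" if "v \<in> V" for v using t f that by (simp add: fixed_points_iff)
    have "supp t = f ` supp t"
    proof (intro equalityI subsetI)
      fix v assume v: "v \<in> supp t"
      then obtain u where "u \<in> V" "v = f u" using tV bij_betw_imp_surj_on[OF bij] by blast
      then show "v \<in> f ` supp t" using v inv by (auto simp: supp_def)
    qed (use tV inv in \<open>auto simp: supp_def\<close>)
    then have "spread \<tau> t (f w) = (\<Sum>v\<in>f ` supp t. t v * push \<tau> v (f w))"
      by (simp add: spread_def)
    also have "\<dots> = (\<Sum>v\<in>supp t. t (f v) * push \<tau> (f v) (f w))"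
      using inj_on_subset[OF bij_betw_imp_inj_on[OF bij] tV] by (simp add: sum.reindex)
    also have "\<dots> = spread \<tau> t w"
      unfolding spread_def
      by (rule sum.cong[OF refl]) (use tV in \<open>auto simp: inv push_action f w subset_iff\<close>)
    finally show ?thesis .
  qed
  then show ?thesis using spread_point[OF point] by (simp add: fixed_points_iff)
qed

lemma spread_start: "t \<in> realization_points flag_complex \<Longrightarrow> spread 0 t = t"
  using flag_pointD(2) by (auto simp: spread_def push_start supp_def if_distrib cong: if_cong)

lemma spread_end:
  assumes "t \<in> realization_points flag_complex" "w \<in> supp (spread 1 t)"
  shows "w \<in> V" "\<rho> w \<le> m"
proof -
  obtain v where "v \<in> supp t" "push 1 v w \<noteq> 0" using assms(2) by (rule supp_spread)
  then show "w \<in> V" "\<rho> w \<le> m"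
    using push_carrier push_end flag_pointD(3)[OF assms(1)] by blast+
qed

text \<open>
  On the open star of a vertex \<open>v\<close>, all supports lie in the finite neighbourhood of \<open>v\<close>, and there
  the motion is given by one finite sum of continuous terms. This includes time \<open>0\<close>, at which
  infinitely many pushes accumulate.
\<close>

lemma continuous_spread:
  "continuous_on (T \<times> realization_points flag_complex) (\<lambda>(\<tau>, t). spread \<tau> t)"
    (is "continuous_on ?D _")
proof (rule continuous_on_coordinatewise_then_product)
  fix w
  have "((\<lambda>x. spread (fst x) (snd x) w) \<longlongrightarrow> spread \<tau> t w) (at (\<tau>, t) within ?D)"
    if "(\<tau>, t) \<in> ?D" for \<tau> t
  proof -
    have t: "t \<in> realization_points flag_complex" using that by simp
    then obtain v where v: "v \<in> supp t"
      by (auto simp: realization_points_def flag_complex_def)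
    define star where "star = {x::real \<times> ('v \<Rightarrow> real). snd x v \<noteq> 0}"
    have coord: "continuous_on UNIV (\<lambda>x::real \<times> ('v \<Rightarrow> real). snd x u)" for u
      by (rule continuous_on_compose2[OF continuous_on_product_coordinates])
         (auto intro: continuous_on_snd continuous_on_id)
    have star: "open star"
      unfolding star_def by (intro open_Collect_neq coord continuous_on_const)
    define N where "N = {u \<in> V. R v u}"
    have N: "finite N" unfolding N_def using locally_finite flag_pointD(3)[OF t] v by blast
    \<comment> \<open>Points of the star share one finite index set, independent of the point.\<close>
    have local: "spread (fst x) (snd x) w = (\<Sum>u\<in>N. snd x u * push (fst x) u w)"
      if "x \<in> ?D \<inter> star" for x
    proof -
      have x: "snd x \<in> realization_points flag_complex" "v \<in> supp (snd x)"
        using that by (auto simp: star_def supp_def)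
      then have "supp (snd x) \<subseteq> N" using flag_pointD(3,5)[OF x(1)] by (auto simp: N_def)
      then show ?thesis
        unfolding spread_def by (intro sum.mono_neutral_left N) (auto simp: supp_def)
    qed
    have "continuous_on (?D \<inter> star) (\<lambda>x. \<Sum>u\<in>N. snd x u * push (fst x) u w)"
    proof (intro continuous_on_sum continuous_on_mult)
      show "continuous_on (?D \<inter> star) (\<lambda>x. snd x u)" for u
        using coord by (rule continuous_on_subset) simp
      show "continuous_on (?D \<inter> star) (\<lambda>x. push (fst x) u w)" for u
        by (rule continuous_on_compose2[OF continuous_push[of UNIV]])
           (auto intro: continuous_on_fst continuous_on_id)
    qed
    then have "continuous_on (?D \<inter> star) (\<lambda>x. spread (fst x) (snd x) w)"
      by (subst continuous_on_cong[OF refl local]) simp_all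
    moreover have "(\<tau>, t) \<in> ?D \<inter> star" using that v by (simp add: star_def supp_def)
    ultimately have "((\<lambda>x. spread (fst x) (snd x) w) \<longlongrightarrow> spread (fst (\<tau>, t)) (snd (\<tau>, t)) w)
        (at (\<tau>, t) within (?D \<inter> star))"
      unfolding continuous_on_def by (rule bspec)
    moreover have "at (\<tau>, t) within ?D = at (\<tau>, t) within (?D \<inter> star)"
      by (rule at_within_nhd[of _ star]) (use star v in \<open>auto simp: star_def supp_def\<close>)
    ultimately show ?thesis by simp
  qed
  then show "continuous_on ?D (\<lambda>x. (case x of (\<tau>, t) \<Rightarrow> spread \<tau> t) w)"
    by (auto simp: continuous_on_def case_prod_unfold)
qed

text \<open>The barycentre of the core is fixed, because the symmetries preserve levels.\<close>

lemma core_fixed_point: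
  obtains a where "a \<in> fixed_points" "supp a \<subseteq> {v \<in> V. \<rho> v \<le> m}"
proof -
  define C where "C = {v \<in> V. \<rho> v \<le> m}"
  obtain c where c: "c \<in> C" using core_nonempty by (auto simp: C_def)
  have "finite {w \<in> V. R c w}" using c locally_finite by (simp add: C_def)
  then have C: "finite C"
    by (rule rev_finite_subset) (use c core_clique in \<open>auto simp: C_def\<close>)
  define a where "a = (\<lambda>v. if v \<in> C then 1 / real (card C) else 0)"
  have supp: "supp a \<subseteq> C" by (auto simp: a_def supp_def)
  have "card C \<noteq> 0" using C c by auto
  then have "(\<Sum>v\<in>C. a v) = 1" by (simp add: a_def)
  moreover have "R u v" if "u \<in> supp a" "v \<in> supp a" for u v
    using that supp core_clique unfolding C_def by blast
  moreover have "0 \<le> a v" for v by (simp add: a_def)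
  moreover have "supp a \<subseteq> V" using supp by (auto simp: C_def)
  ultimately have "a \<in> realization_points flag_complex"
    using supp C by (intro flag_pointI[of a C])
  moreover have "a (f v) = a v" if "f \<in> A" "v \<in> V" for f v
    using that action_level bij_betwE[OF action_bij] by (simp add: a_def C_def)
  ultimately have "a \<in> fixed_points" by (simp add: fixed_points_iff)
  then show ?thesis using that supp by (simp add: C_def)
qed

lemma segment_fixed:
  assumes t: "t \<in> fixed_points" "supp t \<subseteq> {v \<in> V. \<rho> v \<le> m}"
    and a: "a \<in> fixed_points" "supp a \<subseteq> {v \<in> V. \<rho> v \<le> m}"
    and s: "0 \<le> s" "s \<le> 1"
  shows "(\<lambda>v. (1 - s) * t v + s * a v) \<in> fixed_points"
proof -
  let ?x = "\<lambda>v. (1 - s) * t v + s * a v"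
  have points: "t \<in> realization_points flag_complex" "a \<in> realization_points flag_complex"
    using t a by (simp_all add: fixed_points_iff)
  note tD = flag_pointD[OF points(1)] and aD = flag_pointD[OF points(2)]
  have sub: "supp ?x \<subseteq> supp t \<union> supp a" by (auto simp: supp_def)
  have "(\<Sum>v\<in>supp t \<union> supp a. t v) = (\<Sum>v\<in>supp t. t v)"
    "(\<Sum>v\<in>supp t \<union> supp a. a v) = (\<Sum>v\<in>supp a. a v)"
    using tD(2) aD(2) by (auto intro!: sum.mono_neutral_right simp: supp_def)
  then have "(\<Sum>v\<in>supp t \<union> supp a. ?x v) = 1"
    using tD(4) aD(4) by (simp add: sum.distrib flip: sum_distrib_left)
  moreover have "R u v" if "u \<in> supp ?x" "v \<in> supp ?x" for u v
    using that sub t(2) a(2) core_clique by blast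
  ultimately have "?x \<in> realization_points flag_complex"
    using tD(1,2,3) aD(1,2,3) sub s by (intro flag_pointI[of ?x "supp t \<union> supp a"]) auto
  then show ?thesis using t a by (simp add: fixed_points_iff)
qed

lemma contractible_fixed_points: "contractible fixed_points"
proof -
  let ?X = "fixed_points"
  obtain a where a: "a \<in> ?X" "supp a \<subseteq> {v \<in> V. \<rho> v \<le> m}" by (rule core_fixed_point)
  have sub: "?X \<subseteq> realization_points flag_complex" by (auto simp: fixed_points_iff)
  have cont: "continuous_on (T \<times> ?X) (\<lambda>(\<tau>, t). spread \<tau> t)" for T
    using continuous_spread by (rule continuous_on_subset) (use sub in auto)
  have cont1: "continuous_on ?X (spread 1)"
  proof -
    have "continuous_on ?X (Pair (1::real))"
      by (intro continuous_on_Pair continuous_on_const continuous_on_id)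
    then show ?thesis using continuous_on_compose2[OF cont[of UNIV], of ?X "Pair 1"] by auto
  qed
  have "homotopic_with_canon (\<lambda>_. True) ?X ?X id (spread 1)"
  proof (subst homotopic_with, simp, intro exI[of _ "\<lambda>(\<tau>, t). spread \<tau> t"] conjI)
    show "continuous_map (prod_topology (top_of_set {0..1}) (top_of_set ?X)) (top_of_set ?X)
        (\<lambda>(\<tau>, t). spread \<tau> t)"
      using cont spread_fixed by (auto simp: continuous_map_subtopology_eu)
  qed (use sub spread_start in auto)
  moreover have "homotopic_with_canon (\<lambda>_. True) ?X ?X (spread 1) (\<lambda>_. a)"
  proof (subst homotopic_with, simp,
      intro exI[of _ "\<lambda>(s, t). \<lambda>v. (1 - s) * spread 1 t v + s * a v"] conjI)
    have "continuous_on ({0..1} \<times> ?X) (\<lambda>x. spread 1 (snd x) v)" for v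
      by (rule continuous_on_compose2[OF continuous_on_product_then_coordinatewise[OF cont1]])
         (auto intro: continuous_on_snd continuous_on_id)
    then have "continuous_on ({0..1} \<times> ?X) (\<lambda>(s, t). \<lambda>v. (1 - s) * spread 1 t v + s * a v)"
      unfolding case_prod_unfold
      by (intro continuous_on_coordinatewise_then_product continuous_on_add continuous_on_mult
          continuous_on_diff continuous_on_const continuous_on_fst continuous_on_id)
    moreover have "(\<lambda>v. (1 - s) * spread 1 t v + s * a v) \<in> ?X"
      if "s \<in> {0..1}" "t \<in> ?X" for s t
    proof (rule segment_fixed[OF spread_fixed _ a])
      show "supp (spread 1 t) \<subseteq> {v \<in> V. \<rho> v \<le> m}" using spread_end sub that(2) by blast
    qed (use that in auto)
    ultimately show "continuous_map (prod_topology (top_of_set {0..1}) (top_of_set ?X))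
        (top_of_set ?X) (\<lambda>(s, t). \<lambda>v. (1 - s) * spread 1 t v + s * a v)"
      by (auto simp: continuous_map_subtopology_eu)
  qed auto
  ultimately show ?thesis
    unfolding contractible_def using homotopic_with_trans by blast
qed

theorem nonempty_contractible_fixed_points:
  "nonempty_contractible_space (subtopology (realization flag_complex) fixed_points)"
proof -
  have "finite {\<sigma> \<in> flag_complex. v \<in> \<sigma>}" for v
  proof (cases "v \<in> V")
    case True
    have "{\<sigma> \<in> flag_complex. v \<in> \<sigma>} \<subseteq> Pow {w \<in> V. R v w}" by (auto simp: flag_complex_def)
    then show ?thesis using locally_finite[OF True] by (meson finite_Pow_iff finite_subset)
  next
    case False
    then have "{\<sigma> \<in> flag_complex. v \<in> \<sigma>} = {}" by (auto simp: flag_complex_def)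
    then show ?thesis by (simp only: finite.emptyI)
  qed
  then have "realization flag_complex = top_of_set (realization_points flag_complex)"
    by (rule realization_locally_finite) (simp add: flag_complex_def)
  moreover have "fixed_points \<subseteq> realization_points flag_complex" by (auto simp: fixed_points_iff)
  ultimately have "subtopology (realization flag_complex) fixed_points = top_of_set fixed_points"
    by (simp add: subtopology_subtopology Int_absorb1)
  then show ?thesis
    using contractible_fixed_points core_fixed_point
    by (auto simp: nonempty_contractible_space_def)
qed

end

section \<open>Finite subgroups of hyperbolic groups\<close>

locale hyperbolic_finite_subgroup = word_metric G S for G (structure) and S +
  fixes \<delta> :: real and H :: "'a set"
  assumes \<delta>_nonneg: "0 \<le> \<delta>" and hyperbolic: "hyperbolic_group G S \<delta>"
    and H_subgroup: "subgroup H G" and H_finite: "finite H"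
begin

text \<open>
  The function \<open>radius\<close> replaces the distance to a base point, as \<open>H\<close> need not fix any vertex.
\<close>

definition radius :: "'a \<Rightarrow> nat" where
  "radius v = Max ((\<lambda>h. dist_S h v) ` H)"

lemma H_carrier: "h \<in> H \<Longrightarrow> h \<in> carrier G"
  using subgroup.subset[OF H_subgroup] by blast

lemma H_one: "\<one> \<in> H"
  using subgroup.one_closed[OF H_subgroup] .

lemma radius_ge: "h \<in> H \<Longrightarrow> dist_S h v \<le> radius v"
  unfolding radius_def using H_finite by (intro Max_ge) auto

lemma radius_attained:
  obtains h where "h \<in> H" "radius v = dist_S h v"
proof -
  have "radius v \<in> (\<lambda>h. dist_S h v) ` H"
    unfolding radius_def using H_finite H_one by (intro Max_in) auto
  then show ?thesis using that by blast
qed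

lemma radius_mult_left:
  assumes h: "h \<in> H" and v: "v \<in> carrier G"
  shows "radius (h \<otimes> v) = radius v"
proof -
  have le: "radius v \<le> radius (h \<otimes> v)" if h: "h \<in> H" and v: "v \<in> carrier G" for h v
  proof -
    obtain k where k: "k \<in> H" "radius v = dist_S k v" by (rule radius_attained)
    have "radius v = dist_S (h \<otimes> k) (h \<otimes> v)"
      using k h v by (simp add: word_dist_mult_left H_carrier)
    also have "\<dots> \<le> radius (h \<otimes> v)"
      using subgroup.m_closed[OF H_subgroup h k(1)] by (rule radius_ge)
    finally show ?thesis .
  qed
  have "inv h \<otimes> (h \<otimes> v) = v" using h v H_carrier by (simp flip: m_assoc)
  then have "radius (h \<otimes> v) \<le> radius v"
    using le[OF subgroup.m_inv_closed[OF H_subgroup h], of "h \<otimes> v"] h v H_carrier by simp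
  then show ?thesis using le[OF h v] by simp
qed

text \<open>
  Take the four-point inequality with a farthest point of \<open>H\<close> from \<open>p\<close> as fourth point: on the left
  its distance is \<open>radius p\<close>, and on the right its distances are bounded by the other two radii.
\<close>

lemma radius_four_point:
  assumes "p \<in> carrier G" "q \<in> carrier G" "r \<in> carrier G"
  shows "real (radius p) + real (dist_S q r) \<le>
    max (real (dist_S p q) + real (radius r)) (real (dist_S p r) + real (radius q)) + 2 * \<delta>"
proof -
  obtain h where h: "h \<in> H" "radius p = dist_S h p" by (rule radius_attained)
  have "real (dist_S p h) + real (dist_S q r) \<le>
      max (real (dist_S p q) + real (dist_S h r)) (real (dist_S p r) + real (dist_S h q)) + 2 * \<delta>"
    using hyperbolic assms H_carrier[OF h(1)]
    unfolding hyperbolic_group_def gromov_hyperbolic_def by blast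
  moreover have "dist_S p h = radius p" using h assms H_carrier by (simp add: word_dist_commute)
  ultimately show ?thesis using radius_ge[OF h(1), of q] radius_ge[OF h(1), of r] by linarith
qed

text \<open>
  The midpoint of two vertices of small radius has a radius smaller by about half their distance.
  Since no radius falls below \<open>n0\<close>, the distance cannot be large.
\<close>

lemma sublevel_diameter:
  assumes n0: "\<And>w. w \<in> carrier G \<Longrightarrow> n0 \<le> radius w"
    and uv: "u \<in> carrier G" "v \<in> carrier G" and rad: "radius u \<le> n" "radius v \<le> n"
  shows "real (dist_S u v) + 2 * real n0 \<le> 2 * real n + 4 * \<delta> + 1"
proof -
  define D where "D = dist_S u v"
  define k where "k = D div 2"
  have "k \<le> dist_S u v" by (simp add: k_def D_def)
  then obtain w where w: "w \<in> carrier G" "dist_S u w \<le> k" "dist_S w v \<le> D - k"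
    unfolding D_def by (rule word_dist_interpolate[OF uv])
  have "2 * (D - k) \<le> D + 1" "2 * k \<le> D + 1" by (auto simp: k_def)
  then have "2 * dist_S w u \<le> D + 1" "2 * dist_S w v \<le> D + 1"
    using w uv by (simp_all add: word_dist_commute[of w u])
  then have half: "2 * real (dist_S w u) \<le> real D + 1" "2 * real (dist_S w v) \<le> real D + 1"
    by linarith+
  have rads: "real n0 \<le> real (radius w)" "real (radius u) \<le> real n" "real (radius v) \<le> real n"
    using n0[OF w(1)] rad by simp_all
  have "real (radius w) + real D \<le>
      max (real (dist_S w u) + real (radius v)) (real (dist_S w v) + real (radius u)) + 2 * \<delta>"
    unfolding D_def using radius_four_point w(1) uv by blast
  then consider "real (radius w) + real D \<le> real (dist_S w u) + real (radius v) + 2 * \<delta>"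
    | "real (radius w) + real D \<le> real (dist_S w v) + real (radius u) + 2 * \<delta>"
    by (auto simp: max_def split: if_splits)
  then have "real D + 2 * real n0 \<le> 2 * real n + 4 * \<delta> + 1"
  proof cases
    case 1
    then show ?thesis using half(1) rads by linarith
  next
    case 2
    then show ?thesis using half(2) rads by linarith
  qed
  then show ?thesis by (simp add: D_def)
qed

text \<open>
  The vertex \<open>w\<close> lies at distance \<open>2 * J\<close> from \<open>v\<close> on a geodesic from \<open>v\<close> to \<open>c\<close>. The four-point
  inequality for \<open>w\<close>, \<open>v\<close>, \<open>c\<close> shows that this step lowers the radius by at least
  \<open>2 * J - 2 * \<delta> \<ge> J\<close>; the hypothesis on \<open>radius c\<close> ensures that the step does not overshoot.
  The same inequality for \<open>v\<close>, \<open>w\<close>, \<open>y\<close> converts this gain \<open>J \<ge> 2 * \<delta>\<close> into the absence of loss in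
  the distance to \<open>y\<close>.
\<close>

lemma exists_dominating_vertex:
  fixes d J :: nat
  assumes c: "c \<in> carrier G" and J: "0 < J" "2 * \<delta> \<le> real J" and d: "2 * real J + 2 * \<delta> \<le> real d"
    and v: "v \<in> carrier G" and far: "radius c + 2 * J \<le> radius v"
  shows "\<exists>w\<in>carrier G. radius w < radius v \<and>
    (\<forall>y\<in>carrier G. radius y \<le> radius v \<longrightarrow> dist_S v y \<le> d \<longrightarrow> dist_S w y \<le> d)"
proof -
  have D: "radius v \<le> dist_S v c + radius c"
  proof -
    obtain h where h: "h \<in> H" "radius v = dist_S h v" by (rule radius_attained)
    have "dist_S h v \<le> dist_S h c + dist_S c v"
      using word_dist_triangle h c v H_carrier by blast
    then show ?thesis
      using h radius_ge[OF h(1), of c] word_dist_commute[OF c v] by linarith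
  qed
  then have "2 * J \<le> dist_S v c" using far by linarith
  then obtain w where w: "w \<in> carrier G" "dist_S v w \<le> 2 * J" "dist_S w c \<le> dist_S v c - 2 * J"
    by (rule word_dist_interpolate[OF v c])
  have "real (radius w) + real (dist_S v c) \<le>
      max (real (dist_S w v) + real (radius c)) (real (dist_S w c) + real (radius v)) + 2 * \<delta>"
    using radius_four_point w v c by blast
  moreover have "real (dist_S w v) \<le> 2 * real J" using w v by (simp add: word_dist_commute[of w v])
  moreover have "real (dist_S w c) \<le> real (dist_S v c) - 2 * real J" using w(3) D far by linarith
  ultimately have closer: "real (radius w) \<le> real (radius v) - real J"
    using D far J by linarith
  then have "radius w < radius v" using J by linarith
  moreover have "dist_S w y \<le> d"
    if y: "y \<in> carrier G" "radius y \<le> radius v" "dist_S v y \<le> d" for y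
  proof -
    have "real (radius v) + real (dist_S w y) \<le>
        max (real (dist_S v w) + real (radius y)) (real (dist_S v y) + real (radius w)) + 2 * \<delta>"
      using radius_four_point v w y by blast
    moreover have "real (dist_S v w) \<le> 2 * real J" using w(2) by linarith
    ultimately have "real (dist_S w y) \<le> real d" using closer y J d by linarith
    then show ?thesis by simp
  qed
  ultimately show ?thesis using w(1) by blast
qed

theorem contractible_rips_fixed_points:
  fixes d :: nat
  assumes d: "12 * \<delta> + 7 \<le> real d"
  shows "nonempty_contractible_space
    (subtopology (realization (rips_complex G S d)) (rips_fixed_points G S d H))"
proof -
  obtain c where c: "c \<in> carrier G" and least: "\<And>w. w \<in> carrier G \<Longrightarrow> radius c \<le> radius w"
    using ex_has_least_nat[where P = "\<lambda>v. v \<in> carrier G" and m = radius, OF one_closed] by metis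
  \<comment> \<open>The step length is \<open>2 * J\<close>, and the core consists of the radii at which a full step towards \<open>c\<close>
    would overshoot. Its diameter is at most \<open>2 * (2 * J - 1) + 4 * \<delta> + 1\<close>, where \<open>J \<le> 2 * \<delta> + 2\<close>;
    this is the bound \<open>12 * \<delta> + 7\<close>.\<close>
  define J where "J = nat \<lceil>2 * \<delta>\<rceil> + 1"
  have "real J = of_int \<lceil>2 * \<delta>\<rceil> + 1" using \<delta>_nonneg by (simp add: J_def)
  then have J: "0 < J" "2 * \<delta> \<le> real J" "real J \<le> 2 * \<delta> + 2"
    using ceiling_correct[of "2 * \<delta>"] by (simp add: J_def, linarith+)
  define m where "m = radius c + 2 * J - 1"
  have m: "real m = real (radius c) + 2 * real J - 1" using J(1) by (simp add: m_def of_nat_diff)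
  interpret dominated_flag_complex "carrier G" "\<lambda>g h. dist_S g h \<le> d" radius m
    "(\<lambda>h g. h \<otimes> g) ` H"
  proof
    show "finite {w \<in> carrier G. dist_S v w \<le> d}" if "v \<in> carrier G" for v
      using that by (rule finite_word_ball)
    show "dist_S u v \<le> d"
      if "u \<in> carrier G" "v \<in> carrier G" "radius u \<le> m" "radius v \<le> m" for u v
    proof -
      have "real (dist_S u v) + 2 * real (radius c) \<le> 2 * real m + 4 * \<delta> + 1"
        using sublevel_diameter[OF least] that by blast
      then have "real (dist_S u v) \<le> real d" using m J(3) d by linarith
      then show ?thesis by simp
    qed
    have "radius c \<le> m" using J(1) by (simp add: m_def)
    then show "\<exists>v\<in>carrier G. radius v \<le> m" using c by blast
    show "\<exists>w\<in>carrier G. radius w < radius v \<and>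
        (\<forall>y\<in>carrier G. radius y \<le> radius v \<longrightarrow> dist_S v y \<le> d \<longrightarrow> dist_S w y \<le> d)"
      if "v \<in> carrier G" "m < radius v" for v
      using that J d \<delta>_nonneg by (intro exists_dominating_vertex[OF c, of J]) (auto simp: m_def)
    show "bij_betw f (carrier G) (carrier G)" if f: "f \<in> (\<lambda>h g. h \<otimes> g) ` H" for f
    proof -
      obtain h where "h \<in> H" and f_eq: "f = (\<lambda>g. h \<otimes> g)" using f by blast
      then have h: "h \<in> carrier G" by (simp add: H_carrier)
      show ?thesis
        unfolding f_eq using h
        by (intro bij_betw_byWitness[where f' = "\<lambda>g. inv h \<otimes> g"]) (auto simp flip: m_assoc)
    qed
  qed (auto simp: word_dist_commute radius_mult_left word_dist_mult_left H_carrier)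
  have "flag_complex = rips_complex G S d"
    by (simp add: flag_complex_def rips_complex_def)
  moreover from this have "fixed_points = rips_fixed_points G S d H"
    by (simp add: fixed_points_def rips_fixed_points_def)
  ultimately show ?thesis using nonempty_contractible_fixed_points by simp
qed

end

theorem proposition7:
  fixes G :: "('a, 'b) monoid_scheme" and S H :: "'a set"
    and \<delta> :: real and d :: nat
  assumes "group G"
    and "finite S" and "S \<subseteq> carrier G" and "set_inv\<^bsub>G\<^esub> S = S" and "\<one>\<^bsub>G\<^esub> \<notin> S"
    and "generate G S = carrier G"
    and "\<delta> \<ge> 0" and "hyperbolic_group G S \<delta>"
    and "real d \<ge> 32 * \<delta> + 20"
    and "subgroup H G" and "finite H"
  shows "nonempty_contractible_space
    (subtopology (realization (rips_complex G S d)) (rips_fixed_points G S d H))"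
proof -
  interpret hyperbolic_finite_subgroup G S \<delta> H
    by (intro hyperbolic_finite_subgroup.intro word_metric.intro word_metric_axioms.intro
        hyperbolic_finite_subgroup_axioms.intro) fact+
  show ?thesis
    by (rule contractible_rips_fixed_points) (use assms(7,9) in linarith)
qed

end
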